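(* Let $n\geq 2$ be an integer and let $M$ be an $n$-connected binary matroid with $|E(M)|\geq 2n-2$. Suppose $T\subset E(M)$ with $|T|=n-1$. Then the following are equivalent: (i) $M'_T$ is $n$-connected; (ii) $|Q|\geq 2|Q\cap T|$ for every cocircuit $Q$ of $M$ with $Q\cap T\neq\emptyset$; (iii) for every subset $A\subset E(M)$ with $|A|=n-2$, there exists a circuit $C$ of $M$ with $|C\cap T|$ odd and $C\subseteq E(M)-A$.
   Context: Element splitting: let $M$ be a binary matroid with standard matrix representation $A$ over $GF(2)$ and $T\subseteq E(M)$. Let $A'_T$ be the matrix obtained from $A$ by adjoining an extra row whose entries are $1$ in the columns labelled by elements of $T$ and $0$ otherwise, and then adjoining an extra column labelled by a new element $a$ with $1$ in the last row and $0$ elsewhere. $M'_T$ denotes the vector matroid of $A'_T$. A matroid is $n$-connected if it has no $k$-separation for any $k<n$, where a $k$-separation of a matroid $N$ with rank function $r$ is a partition $(X,Y)$ of $E(N)$ with $\min\{|X|,|Y|\}\geq k$ and $r(X)+r(Y)-r(E(N))\leq k-1$. *)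

theory Defs
  imports Main "HOL-Library.Z2"
begin

record 'e matroid_data =
  ground :: "'e set"
  indep :: "'e set \<Rightarrow> bool"

definition matroid :: "'e matroid_data \<Rightarrow> bool" where
  "matroid M \<longleftrightarrow>
     finite (ground M) \<and>
     (\<forall>X. indep M X \<longrightarrow> X \<subseteq> ground M) \<and>
     indep M {} \<and>
     (\<forall>X Y. indep M X \<longrightarrow> Y \<subseteq> X \<longrightarrow> indep M Y) \<and>
     (\<forall>X Y. indep M X \<longrightarrow> indep M Y \<longrightarrow> card X < card Y \<longrightarrow>
        (\<exists>y \<in> Y - X. indep M (insert y X)))"

definition rank :: "'e matroid_data \<Rightarrow> 'e set \<Rightarrow> nat" where
  "rank M X = Max {card I | I. I \<subseteq> X \<and> indep M I}"

definition basis :: "'e matroid_data \<Rightarrow> 'e set \<Rightarrow> bool" where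
  "basis M B \<longleftrightarrow> indep M B \<and> (\<forall>I. indep M I \<longrightarrow> B \<subseteq> I \<longrightarrow> I = B)"

definition circuit :: "'e matroid_data \<Rightarrow> 'e set \<Rightarrow> bool" where
  "circuit M C \<longleftrightarrow> C \<subseteq> ground M \<and> \<not> indep M C \<and> (\<forall>D. D \<subset> C \<longrightarrow> indep M D)"

definition dual :: "'e matroid_data \<Rightarrow> 'e matroid_data" where
  "dual M = \<lparr>ground = ground M,
             indep = (\<lambda>X. X \<subseteq> ground M \<and> (\<exists>B. basis M B \<and> X \<inter> B = {}))\<rparr>"

definition cocircuit :: "'e matroid_data \<Rightarrow> 'e set \<Rightarrow> bool" where
  "cocircuit M Q \<longleftrightarrow> circuit (dual M) Q"

(* The connectivity r(X) + r(Y) - r(E) is taken in the integers, to avoid truncated subtraction. *)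
definition separation :: "'e matroid_data \<Rightarrow> nat \<Rightarrow> 'e set \<Rightarrow> 'e set \<Rightarrow> bool" where
  "separation M k X Y \<longleftrightarrow>
     X \<union> Y = ground M \<and> X \<inter> Y = {} \<and>
     min (card X) (card Y) \<ge> k \<and>
     int (rank M X) + int (rank M Y) - int (rank M (ground M)) \<le> int k - 1"

definition n_connected :: "nat \<Rightarrow> 'e matroid_data \<Rightarrow> bool" where
  "n_connected n M \<longleftrightarrow> (\<forall>k X Y. 1 \<le> k \<longrightarrow> k < n \<longrightarrow> \<not> separation M k X Y)"

(* A matrix over GF(2) with m rows and columns labelled by a set E is a function
   A :: nat => 'e => bit, of which only the entries A i x with i < m and x in E matter.
   Independence is that of the indexed family of columns, so two equal columns are dependent. *)
definition vector_matroid :: "nat \<Rightarrow> 'e set \<Rightarrow> (nat \<Rightarrow> 'e \<Rightarrow> bit) \<Rightarrow> 'e matroid_data" where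
  "vector_matroid m E A =
     \<lparr>ground = E,
      indep = (\<lambda>X. X \<subseteq> E \<and>
        (\<forall>c :: 'e \<Rightarrow> bit. (\<forall>i<m. (\<Sum>x\<in>X. c x * A i x) = 0) \<longrightarrow> (\<forall>x\<in>X. c x = 0)))\<rparr>"

(* The matrix has the form [I | D] up to the order of the labelled columns:
   b i is the label of the i-th column of the identity block. *)
definition standard_representation ::
    "'e matroid_data \<Rightarrow> nat \<Rightarrow> (nat \<Rightarrow> 'e \<Rightarrow> bit) \<Rightarrow> bool" where
  "standard_representation M m A \<longleftrightarrow>
     M = vector_matroid m (ground M) A \<and>
     (\<exists>b. inj_on b {..<m} \<and> b ` {..<m} \<subseteq> ground M \<and>
          (\<forall>i<m. \<forall>j<m. A i (b j) = (if i = j then 1 else 0)))"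

(* The rows of A are 0, ..., m - 1, so the new row has index m. *)
definition splitting_matrix ::
    "nat \<Rightarrow> (nat \<Rightarrow> 'e \<Rightarrow> bit) \<Rightarrow> 'e set \<Rightarrow> 'e \<Rightarrow> nat \<Rightarrow> 'e \<Rightarrow> bit" where
  "splitting_matrix m A T a i x =
     (if x = a then (if i = m then 1 else 0)
      else if i = m then (if x \<in> T then 1 else 0)
      else A i x)"

definition element_splitting ::
    "'e set \<Rightarrow> nat \<Rightarrow> (nat \<Rightarrow> 'e \<Rightarrow> bit) \<Rightarrow> 'e set \<Rightarrow> 'e \<Rightarrow> 'e matroid_data" where
  "element_splitting E m A T a = vector_matroid (Suc m) (insert a E) (splitting_matrix m A T a)"

end

theory Submission
  imports Defs
begin

text \<open>Identify a binary matroid with its cycle space, the sets of elements whose columns sum to \<open>0\<close>.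
  The cocycles are the sets meeting every cycle evenly, and a set that meets every cycle inside
  \<open>Y\<close> evenly agrees on \<open>Y\<close> with some cocycle. Hence (iii) says that \<open>Q \<Delta> T\<close> has at least
  \<open>n - 1 = |T|\<close> elements for every cocycle \<open>Q\<close>, i.e. \<open>|Q| \<ge> 2|Q \<inter> T|\<close>, and since cocycles are
  disjoint unions of cocircuits this is (ii).

  For (i), write \<open>r\<close> and \<open>r'\<close> for the two rank functions. Then \<open>r'(X \<union> a) = r(X) + 1\<close>, while
  \<open>r'(Y) = r(Y)\<close> or \<open>r(Y) + 1\<close>, the latter exactly when \<open>Y\<close> contains a circuit meeting \<open>T\<close> oddly.
  A violation \<open>S\<close> of (iii) makes \<open>(S \<union> a, E - S)\<close> an \<open>(n - 1)\<close>-separation. Conversely, a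
  \<open>k\<close>-separation \<open>(X \<union> a, Y)\<close> forces \<open>|X| = k - 1\<close> by connectivity of \<open>M\<close>, and then (iii) gives
  \<open>r'(Y) = r(Y) + 1\<close>, so that \<open>(X, Y)\<close> is a \<open>(k - 1)\<close>-separation of \<open>M\<close>.\<close>

section \<open>Symmetric differences and sums over GF(2)\<close>

lemma even_card_Int_sym_diff:
  assumes "finite C" "finite D"
  shows "even (card (sym_diff C D \<inter> T)) \<longleftrightarrow> (even (card (C \<inter> T)) \<longleftrightarrow> even (card (D \<inter> T)))"
proof -
  have "card (C \<inter> T) = card ((C - D) \<inter> T) + card (C \<inter> D \<inter> T)"
    using assms by (subst card_Un_disjoint[symmetric]) (auto intro: arg_cong[where f = card])
  moreover have "card (D \<inter> T) = card ((D - C) \<inter> T) + card (C \<inter> D \<inter> T)"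
    using assms by (subst card_Un_disjoint[symmetric]) (auto intro: arg_cong[where f = card])
  moreover have "card (sym_diff C D \<inter> T) = card ((C - D) \<inter> T) + card ((D - C) \<inter> T)"
    using assms by (subst card_Un_disjoint[symmetric]) (auto intro: arg_cong[where f = card])
  ultimately show ?thesis by auto
qed

lemma card_sym_diff:
  assumes "finite C" "finite D"
  shows "card (sym_diff C D) + 2 * card (C \<inter> D) = card C + card D"
proof -
  have "card C = card (C - D) + card (C \<inter> D)" "card D = card (D - C) + card (C \<inter> D)"
    using assms by (metis Int_commute card_Diff_subset_Int card_Int_Diff add.commute finite_Int)+
  moreover have "card (sym_diff C D) = card (C - D) + card (D - C)"
    using assms by (subst card_Un_disjoint) auto
  ultimately show ?thesis by simp
qed

lemma sum_sym_diff_bit: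
  fixes f :: "'a \<Rightarrow> bit"
  assumes "finite C" "finite D"
  shows "sum f (sym_diff C D) = sum f C + sum f D"
proof -
  have "sum f C = sum f (C \<inter> D) + sum f (C - D)" "sum f D = sum f (C \<inter> D) + sum f (D - C)"
    using assms by (metis Int_commute sum.Int_Diff)+
  moreover have "sum f (sym_diff C D) = sum f (C - D) + sum f (D - C)"
    using assms by (subst sum.union_disjoint) auto
  moreover have "x + y = (z + x) + (z + y)" for x y z :: bit
    by (cases x; cases y; cases z) auto
  ultimately show ?thesis by metis
qed

lemma sum_indicator_bit_eq_0_iff:
  assumes "finite C"
  shows "(\<Sum>x\<in>C. if x \<in> T then 1 else 0 :: bit) = 0 \<longleftrightarrow> even (card (C \<inter> T))"
  using assms by (induction C) (auto simp: Int_insert_left)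

text \<open>The kernel of the matrix, with each vector replaced by its support: the cycle
  space.\<close>

definition null_sets :: "nat \<Rightarrow> 'e set \<Rightarrow> (nat \<Rightarrow> 'e \<Rightarrow> bit) \<Rightarrow> 'e set set" where
  "null_sets m E A = {C. C \<subseteq> E \<and> (\<forall>i<m. (\<Sum>x\<in>C. A i x) = 0)}"

text \<open>A coefficient vector over GF(2) is the indicator of its support, so a nontrivial
  dependency among the columns in \<open>X\<close> is a nonempty null set inside
  \<open>X\<close>.\<close>

lemma indep_vector_matroid_iff:
  assumes "finite E"
  shows "indep (vector_matroid m E A) X \<longleftrightarrow> X \<subseteq> E \<and> (\<forall>C\<in>null_sets m E A. C \<subseteq> X \<longrightarrow> C = {})"
proof (cases "X \<subseteq> E")
  case True
  then have fin: "finite X" using assms finite_subset by blast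
  have *: "(\<Sum>x\<in>X. c x * A i x) = (\<Sum>x\<in>{x \<in> X. c x = 1}. A i x)" for c :: "'a \<Rightarrow> bit" and i
    unfolding sum.inter_filter[OF fin]
    by (rule sum.cong) auto
  have "(\<forall>c :: 'a \<Rightarrow> bit. (\<forall>i<m. (\<Sum>x\<in>X. c x * A i x) = 0) \<longrightarrow> (\<forall>x\<in>X. c x = 0)) \<longleftrightarrow>
        (\<forall>C\<in>null_sets m E A. C \<subseteq> X \<longrightarrow> C = {})" (is "?l \<longleftrightarrow> ?r")
  proof
    assume l: ?l
    show ?r
    proof (intro ballI impI)
      fix C assume C: "C \<in> null_sets m E A" "C \<subseteq> X"
      let ?c = "\<lambda>x. if x \<in> C then 1 else 0 :: bit"
      have "{x \<in> X. ?c x = 1} = C" using C by auto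
      then have "\<forall>i<m. (\<Sum>x\<in>X. ?c x * A i x) = 0"
        using C unfolding * by (simp add: null_sets_def)
      then have "\<forall>x\<in>X. ?c x = 0" using l[rule_format, of ?c] by blast
      then show "C = {}" using C by (metis subset_iff equals0I one_neq_zero)
    qed
  next
    assume r: ?r
    show ?l
    proof (intro allI impI)
      fix c :: "'a \<Rightarrow> bit" assume "\<forall>i<m. (\<Sum>x\<in>X. c x * A i x) = 0"
      then have "{x \<in> X. c x = 1} \<in> null_sets m E A"
        using True unfolding * by (auto simp: null_sets_def)
      then have "{x \<in> X. c x = 1} = {}" using r[rule_format, of "{x \<in> X. c x = 1}"] by simp
      then show "\<forall>x\<in>X. c x = 0" by simp
    qed
  qed
  then show ?thesis using True by (simp add: vector_matroid_def)
qed (simp add: vector_matroid_def)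

text \<open>The old rows ignore the column of \<open>a\<close>. The new row sums to the parity of
  \<open>card (C \<inter> T)\<close>, and including \<open>a\<close> adds \<open>1\<close> to
  it.\<close>

lemma null_sets_splitting_matrix:
  assumes "finite E" "a \<notin> E" "C \<subseteq> E"
  shows "C \<in> null_sets (Suc m) (insert a E) (splitting_matrix m A T a) \<longleftrightarrow>
           C \<in> null_sets m E A \<and> even (card (C \<inter> T))"
    and "insert a C \<in> null_sets (Suc m) (insert a E) (splitting_matrix m A T a) \<longleftrightarrow>
           C \<in> null_sets m E A \<and> odd (card (C \<inter> T))"
proof -
  have fin: "finite C" and aC: "a \<notin> C" using assms finite_subset by blast+
  let ?A = "splitting_matrix m A T a"
  have old: "(\<Sum>x\<in>C. ?A i x) = (\<Sum>x\<in>C. A i x)" if "i < m" for i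
    using that aC by (intro sum.cong) (auto simp: splitting_matrix_def)
  have new: "(\<Sum>x\<in>C. ?A m x) = (\<Sum>x\<in>C. if x \<in> T then 1 else 0)"
    using aC by (intro sum.cong) (auto simp: splitting_matrix_def)
  have col: "?A i a = (if i = m then 1 else 0)" for i by (simp add: splitting_matrix_def)
  have Csub: "C \<subseteq> insert a E" using assms by blast
  show "C \<in> null_sets (Suc m) (insert a E) ?A \<longleftrightarrow> C \<in> null_sets m E A \<and> even (card (C \<inter> T))"
    using assms(3) Csub old new sum_indicator_bit_eq_0_iff[OF fin, of T]
    by (auto simp: null_sets_def less_Suc_eq)
  have "(1 :: bit) + y = 0 \<longleftrightarrow> y \<noteq> 0" for y by (cases y) auto
  then show "insert a C \<in> null_sets (Suc m) (insert a E) ?A \<longleftrightarrow>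
      C \<in> null_sets m E A \<and> odd (card (C \<inter> T))"
    using assms(3) Csub old new sum_indicator_bit_eq_0_iff[OF fin, of T] fin aC
    by (auto simp: null_sets_def less_Suc_eq col)
qed

section \<open>Rank\<close>

lemma rank_ge:
  assumes "finite X" "I \<subseteq> X" "indep M I"
  shows "card I \<le> rank M X"
proof -
  have "{card I | I. I \<subseteq> X \<and> indep M I} \<subseteq> card ` Pow X" by blast
  then have "finite {card I | I. I \<subseteq> X \<and> indep M I}"
    using assms(1) by (meson finite_Pow_iff finite_imageI finite_subset)
  then show ?thesis unfolding rank_def using assms by (intro Max_ge) auto
qed

lemma rank_witness:
  assumes "finite X" "indep M {}"
  obtains I where "I \<subseteq> X" "indep M I" "card I = rank M X"
proof -
  have "{card I | I. I \<subseteq> X \<and> indep M I} \<subseteq> card ` Pow X" by blast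
  then have "finite {card I | I. I \<subseteq> X \<and> indep M I}"
    using assms(1) by (meson finite_Pow_iff finite_imageI finite_subset)
  then have "rank M X \<in> {card I | I. I \<subseteq> X \<and> indep M I}"
    unfolding rank_def using assms by (intro Max_in) auto
  then show ?thesis using that by auto
qed

lemma indep_extend_to_rank:
  assumes "matroid M" "finite X" "I \<subseteq> X" "indep M I"
  obtains B where "I \<subseteq> B" "B \<subseteq> X" "indep M B" "card B = rank M X"
proof -
  let ?S = "{B. I \<subseteq> B \<and> B \<subseteq> X \<and> indep M B}"
  have "finite ?S" using assms(2) by (auto intro: finite_subset[of _ "Pow X"])
  moreover have "?S \<noteq> {}" using assms by blast
  ultimately have "Max (card ` ?S) \<in> card ` ?S" by (intro Max_in) auto
  then obtain B where B: "B \<in> ?S" and "card B = Max (card ` ?S)" by auto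
  then have max: "card B' \<le> card B" if "B' \<in> ?S" for B'
    using that \<open>finite ?S\<close> by simp
  have "card B = rank M X"
  proof (rule ccontr)
    assume "card B \<noteq> rank M X"
    then have lt: "card B < rank M X" using rank_ge[of X B M] B assms by auto
    obtain J where J: "J \<subseteq> X" "indep M J" "card J = rank M X"
      using rank_witness assms by (metis matroid_def)
    obtain y where "y \<in> J - B" "indep M (insert y B)"
      using assms(1) B J lt unfolding matroid_def by (metis mem_Collect_eq)
    then have "insert y B \<in> ?S" "card (insert y B) > card B"
      using B J finite_subset[OF _ assms(2)] by auto
    then show False using max[of "insert y B"] by simp
  qed
  then show ?thesis using that B by blast
qed

section \<open>Cycles and cocycles\<close>

text \<open>Stated abstractly so that the same facts serve \<open>M\<close> with its cycles and
  \<open>dual M\<close> with the cocycles.\<close>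

locale cycle_space =
  fixes M :: "'e matroid_data" and Z :: "'e set set"
  assumes finite_ground: "finite (ground M)"
    and cycle_subset: "C \<in> Z \<Longrightarrow> C \<subseteq> ground M"
    and empty_cycle: "{} \<in> Z"
    and cycle_sym_diff: "C \<in> Z \<Longrightarrow> D \<in> Z \<Longrightarrow> sym_diff C D \<in> Z"
    and indep_iff: "indep M X \<longleftrightarrow> X \<subseteq> ground M \<and> (\<forall>C\<in>Z. C \<subseteq> X \<longrightarrow> C = {})"
begin

lemma finite_cycle: "C \<in> Z \<Longrightarrow> finite C"
  using cycle_subset finite_ground finite_subset by blast

lemma circuit_in_cycles:
  assumes "circuit M C"
  shows "C \<in> Z" "C \<noteq> {}"
proof -
  obtain D where D: "D \<in> Z" "D \<subseteq> C" "D \<noteq> {}"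
    using assms unfolding circuit_def indep_iff by blast
  then have "\<not> indep M D" unfolding indep_iff by blast
  then have "D = C" using assms D(2) unfolding circuit_def by blast
  then show "C \<in> Z" "C \<noteq> {}" using D by auto
qed

lemma contains_circuit:
  assumes "X \<subseteq> ground M" "\<not> indep M X"
  obtains C where "circuit M C" "C \<subseteq> X"
proof -
  have "finite X" using assms(1) finite_ground finite_subset by blast
  then show ?thesis using assms that
  proof (induction X arbitrary: thesis rule: finite_psubset_induct)
    case (psubset X)
    show ?case
    proof (cases "\<forall>D. D \<subset> X \<longrightarrow> indep M D")
      case True
      then have "circuit M X" using psubset.prems unfolding circuit_def by blast
      then show ?thesis using psubset.prems by blast
    next
      case False
      then obtain D where D: "D \<subset> X" "\<not> indep M D" by blast
      then have "D \<subseteq> ground M" using psubset.prems by blast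
      from psubset.IH[OF D(1) this D(2)] obtain C where "circuit M C" "C \<subseteq> D" by metis
      then show ?thesis using D(1) psubset.prems(3)[of C] by blast
    qed
  qed
qed

text \<open>Every cycle is a disjoint union of circuits: removing a circuit \<open>D\<close> from a
  cycle \<open>C\<close> leaves \<open>C - D = sym_diff C D\<close>, which is a smaller
  cycle.\<close>

lemma cycle_induct [consumes 1, case_names empty circuit_Un]:
  assumes "C \<in> Z"
    and empty: "P {}"
    and circuit_Un: "\<And>C D. circuit M D \<Longrightarrow> D \<inter> C = {} \<Longrightarrow> C \<in> Z \<Longrightarrow> P C \<Longrightarrow> P (D \<union> C)"
  shows "P C"
proof -
  have "finite C" using assms(1) finite_cycle by blast
  then show ?thesis using assms(1)
  proof (induction C rule: finite_psubset_induct)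
    case (psubset C)
    show ?case
    proof (cases "C = {}")
      case False
      then have "\<not> indep M C" using psubset.prems unfolding indep_iff by blast
      then obtain D where D: "circuit M D" "D \<subseteq> C"
        using contains_circuit cycle_subset psubset.prems by metis
      have "sym_diff C D = C - D" using D by blast
      then have "C - D \<in> Z" using cycle_sym_diff[OF psubset.prems circuit_in_cycles(1)[OF D(1)]] by simp
      moreover have "C - D \<subset> C" using D circuit_in_cycles[OF D(1)] by blast
      ultimately have "P (D \<union> (C - D))" using psubset.IH D by (intro circuit_Un) auto
      moreover have "D \<union> (C - D) = C" using D by blast
      ultimately show ?thesis by simp
    qed (simp add: empty)
  qed
qed

text \<open>The orthogonal complement of the cycle space over GF(2).\<close>

definition cocycles :: "'e set set" where
  "cocycles = {D. D \<subseteq> ground M \<and> (\<forall>C\<in>Z. even (card (C \<inter> D)))}"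

text \<open>Elements outside \<open>Y\<close> are added one at a time: all cycles that use the new element but no
  later one agree modulo cycles already treated, so one of them decides whether the new
  element belongs to the cocycle.\<close>

lemma cocycle_extension:
  assumes "Y \<subseteq> ground M" and "\<And>C. C \<in> Z \<Longrightarrow> C \<subseteq> Y \<Longrightarrow> even (card (C \<inter> T))"
  obtains D where "D \<in> cocycles" "D \<inter> Y = T \<inter> Y"
proof -
  have "\<exists>D. D \<inter> Y = T \<inter> Y \<and> (\<forall>C\<in>Z. C \<subseteq> Y \<union> F \<longrightarrow> even (card (C \<inter> D)))"
    if "finite F" "F \<inter> Y = {}" for F
    using that
  proof (induction F)
    case empty
    \<comment> \<open>\<open>T\<close> itself serves as \<open>D\<close>.\<close>
    then show ?case using assms(2) by auto
  next
    case (insert e F)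
    have "F \<inter> Y = {}" using insert.prems by blast
    from insert.IH[OF this] obtain D where D: "D \<inter> Y = T \<inter> Y"
      "\<And>C. C \<in> Z \<Longrightarrow> C \<subseteq> Y \<union> F \<Longrightarrow> even (card (C \<inter> D))"
      by metis
    have e: "e \<notin> Y" "e \<notin> F" using insert by auto
    show ?case
    proof (cases "\<exists>C\<in>Z. C \<subseteq> Y \<union> insert e F \<and> odd (card (C \<inter> D))")
      case False
      then show ?thesis using D(1) by blast
    next
      case True
      then obtain C0 where C0: "C0 \<in> Z" "C0 \<subseteq> Y \<union> insert e F" "odd (card (C0 \<inter> D))" by blast
      then have "e \<in> C0" using D(2)[OF C0(1)] by blast
      \<comment> \<open>Toggling \<open>e\<close> changes the parity exactly for the cycles through
        \<open>e\<close>. Each of these differs from \<open>C0\<close> by a cycle inside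
        \<open>Y \<union> F\<close>, so all of them were odd like \<open>C0\<close>.\<close>
      let ?D = "sym_diff D {e}"
      have flip: "even (card (C \<inter> ?D)) \<longleftrightarrow> (even (card (C \<inter> D)) \<longleftrightarrow> e \<notin> C)" if "C \<in> Z" for C
      proof -
        have "finite C" using that finite_cycle by blast
        moreover have "C \<inter> ?D = sym_diff (C \<inter> D) (C \<inter> {e}) \<inter> UNIV" by blast
        moreover have "card (C \<inter> {e}) = (if e \<in> C then 1 else 0)" by simp
        ultimately show ?thesis using even_card_Int_sym_diff[of "C \<inter> D" "C \<inter> {e}" UNIV] by simp
      qed
      have "even (card (C \<inter> ?D))" if C: "C \<in> Z" "C \<subseteq> Y \<union> insert e F" for C
      proof (cases "e \<in> C")
        case True
        then have "sym_diff C C0 \<subseteq> Y \<union> F" using C C0 \<open>e \<in> C0\<close> by blast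
        then have "even (card (sym_diff C C0 \<inter> D))" using D(2) cycle_sym_diff C C0 by blast
        then show ?thesis
          using even_card_Int_sym_diff[of C C0 D] finite_cycle C C0 flip True by blast
      next
        case False
        then have "C \<subseteq> Y \<union> F" using C by blast
        then show ?thesis using D(2) C flip False by blast
      qed
      moreover have "?D \<inter> Y = T \<inter> Y" using D(1) e by blast
      ultimately show ?thesis by blast
    qed
  qed
  from this[of "ground M - Y"] obtain D where D: "D \<inter> Y = T \<inter> Y"
    "\<And>C. C \<in> Z \<Longrightarrow> C \<subseteq> Y \<union> (ground M - Y) \<Longrightarrow> even (card (C \<inter> D))"
    using finite_ground by (metis Diff_disjoint Int_commute finite_Diff)
  \<comment> \<open>\<open>T\<close> is arbitrary here, so \<open>D\<close> may leave the ground set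
    and has to be cut down to it.\<close>
  have "C \<inter> (D \<inter> ground M) = C \<inter> D" if "C \<in> Z" for C using cycle_subset[OF that] by blast
  then have "D \<inter> ground M \<in> cocycles"
    unfolding cocycles_def using D(2) cycle_subset by fastforce
  moreover have "D \<inter> ground M \<inter> Y = T \<inter> Y" using D(1) assms(1) by blast
  ultimately show ?thesis using that by blast
qed

text \<open>Orthogonality of cycles and cocycles: a cycle and a cocycle never meet in a single
  element. This rules out a nonempty cocycle disjoint from a basis, and it shows that a maximal
  independent set outside \<open>X\<close> is a basis when \<open>X\<close> contains no nonempty
  cocycle.\<close>

lemma dual_indep_iff:
  "indep (dual M) X \<longleftrightarrow> X \<subseteq> ground M \<and> (\<forall>D\<in>cocycles. D \<subseteq> X \<longrightarrow> D = {})"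
proof (cases "X \<subseteq> ground M")
  case X: True
  have "(\<exists>B. basis M B \<and> X \<inter> B = {}) \<longleftrightarrow> (\<forall>D\<in>cocycles. D \<subseteq> X \<longrightarrow> D = {})" (is "?l \<longleftrightarrow> ?r")
  proof
    assume ?l
    then obtain B where B: "basis M B" "X \<inter> B = {}" by blast
    show ?r
    proof (intro ballI impI, rule ccontr)
      fix D assume D: "D \<in> cocycles" "D \<subseteq> X" "D \<noteq> {}"
      then obtain e where e: "e \<in> D" by blast
      then have "e \<notin> B" using B D by blast
      then have "\<not> indep M (insert e B)" using B(1) unfolding basis_def by blast
      moreover have "insert e B \<subseteq> ground M"
        using B(1) e D(2) X unfolding basis_def indep_iff by (meson in_mono insert_subset)
      \<comment> \<open>The fundamental circuit of \<open>e\<close> with respect to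
        \<open>B\<close>. As \<open>D\<close> misses \<open>B\<close>, it meets \<open>D\<close> in
        \<open>e\<close> alone.\<close>
      ultimately obtain C where C: "C \<in> Z" "C \<subseteq> insert e B" "C \<noteq> {}" unfolding indep_iff by blast
      moreover have "indep M B" using B(1) unfolding basis_def by simp
      ultimately have "e \<in> C" unfolding indep_iff by blast
      then have "C \<inter> D = {e}" using C e B D by blast
      then show False using D(1) C(1) unfolding cocycles_def by force
    qed
  next
    assume r: ?r
    let ?S = "{I. I \<subseteq> ground M - X \<and> indep M I}"
    have "finite ?S" using finite_ground by (auto intro: finite_subset[of _ "Pow (ground M)"])
    moreover have "{} \<in> ?S" unfolding indep_iff by blast
    then have "?S \<noteq> {}" by (metis empty_iff)
    ultimately obtain I where I: "I \<in> ?S" "\<And>J. J \<in> ?S \<Longrightarrow> I \<subseteq> J \<Longrightarrow> J = I"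
      using finite_has_maximal[of ?S] by metis
    have "basis M I"
    proof (rule ccontr)
      assume "\<not> basis M I"
      then obtain J where J: "indep M J" "I \<subseteq> J" "J \<noteq> I" using I unfolding basis_def by blast
      then obtain f where f: "f \<in> J" "f \<notin> I" by blast
      have If: "indep M (insert f I)" using J f unfolding indep_iff by blast
      have fX: "f \<in> X"
      proof (rule ccontr)
        assume "f \<notin> X"
        then have "insert f I \<in> ?S" using I(1) If unfolding indep_iff by simp
        then show False using I(2)[of "insert f I"] f(2) by blast
      qed
      \<comment> \<open>\<open>insert f I\<close> contains no nonempty cycle, so the parity
        condition is trivial and some cocycle meets \<open>insert f I\<close> exactly in
        \<open>f\<close>.\<close>
      have "even (card (C \<inter> {f}))" if "C \<in> Z" "C \<subseteq> insert f I" for C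
        using If that unfolding indep_iff by force
      then obtain D where D: "D \<in> cocycles" "D \<inter> insert f I = {f} \<inter> insert f I"
        using cocycle_extension[of "insert f I" "{f}"] If unfolding indep_iff by metis
      \<comment> \<open>An element \<open>e\<close> of \<open>D\<close> outside \<open>X\<close>
        would, by maximality of \<open>I\<close>, close a cycle with \<open>I\<close>, and that
        cycle would meet \<open>D\<close> only in \<open>e\<close>.\<close>
      have "D \<subseteq> X"
      proof
        fix e assume e: "e \<in> D"
        show "e \<in> X"
        proof (rule ccontr)
          assume "e \<notin> X"
          have eE: "e \<in> ground M" using e D unfolding cocycles_def by blast
          have "e \<noteq> f" using \<open>e \<notin> X\<close> fX by blast
          then have "e \<notin> I" using e D(2) by blast
          have "\<not> indep M (insert e I)"
          proof
            assume "indep M (insert e I)"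
            then have "insert e I \<in> ?S" using I(1) \<open>e \<notin> X\<close> eE by simp
            then show False using I(2)[of "insert e I"] \<open>e \<notin> I\<close> by blast
          qed
          moreover have "insert e I \<subseteq> ground M" using I eE by blast
          ultimately obtain C where C: "C \<in> Z" "C \<subseteq> insert e I" "C \<noteq> {}"
            unfolding indep_iff by blast
          moreover have "indep M I" using I(1) by simp
          ultimately have "e \<in> C" unfolding indep_iff by (metis subset_insert)
          moreover have "D \<inter> I = {}" using D(2) f(2) by fastforce
          ultimately have "C \<inter> D = {e}" using C(2) e by blast
          then show False using D(1) C(1) unfolding cocycles_def by force
        qed
      qed
      then show False using r D by blast
    qed
    then show ?l using I by blast
  qed
  then show ?thesis using X by (simp add: dual_def)
qed (simp add: dual_def)

lemma dual_cycle_space: "cycle_space (dual M) cocycles"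
proof
  show "finite (ground (dual M))" using finite_ground by (simp add: dual_def)
  show "D \<subseteq> ground (dual M)" if "D \<in> cocycles" for D
    using that by (simp add: dual_def cocycles_def)
  show "{} \<in> cocycles" by (simp add: cocycles_def)
  show "sym_diff D D' \<in> cocycles" if "D \<in> cocycles" "D' \<in> cocycles" for D D'
  proof -
    have "finite D" "finite D'" using that finite_ground finite_subset unfolding cocycles_def by blast+
    then have "even (card (C \<inter> sym_diff D D'))" if "C \<in> Z" for C
      using even_card_Int_sym_diff[of D D' C] \<open>D \<in> cocycles\<close> \<open>D' \<in> cocycles\<close> that
      unfolding cocycles_def by (simp add: Int_commute)
    then show ?thesis using that unfolding cocycles_def by blast
  qed
  show "indep (dual M) X \<longleftrightarrow> X \<subseteq> ground (dual M) \<and> (\<forall>D\<in>cocycles. D \<subseteq> X \<longrightarrow> D = {})" for X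
    using dual_indep_iff by (simp add: dual_def)
qed

text \<open>Parity is additive over the decomposition into disjoint circuits, so one of the circuits
  is odd.\<close>

lemma odd_cycle_contains_odd_circuit:
  assumes "C \<in> Z" "odd (card (C \<inter> T))"
  obtains D where "circuit M D" "D \<subseteq> C" "odd (card (D \<inter> T))"
proof -
  have "odd (card (C \<inter> T)) \<longrightarrow> (\<exists>D. circuit M D \<and> D \<subseteq> C \<and> odd (card (D \<inter> T)))"
    using assms(1)
  proof (induction rule: cycle_induct)
    case (circuit_Un C D)
    have fin: "finite C" "finite D" using circuit_Un circuit_in_cycles finite_cycle by blast+
    have "sym_diff D C = D \<union> C" using circuit_Un by blast
    then have "odd (card ((D \<union> C) \<inter> T)) \<Longrightarrow> odd (card (D \<inter> T)) \<or> odd (card (C \<inter> T))"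
      using even_card_Int_sym_diff[OF fin(2,1), of T] by auto
    then show ?case using circuit_Un by blast
  qed simp
  then show ?thesis using assms that by blast
qed

lemma cocircuit_imp_cocycle:
  assumes "cocircuit M Q"
  shows "Q \<in> cocycles"
  using assms cycle_space.circuit_in_cycles(1)[OF dual_cycle_space] unfolding cocircuit_def by blast

text \<open>Both sides are additive over the decomposition of \<open>D\<close> into disjoint
  cocircuits; those missing \<open>T\<close> satisfy the bound trivially.\<close>

lemma cocycle_card_bound:
  assumes "\<And>Q. cocircuit M Q \<Longrightarrow> Q \<inter> T \<noteq> {} \<Longrightarrow> 2 * card (Q \<inter> T) \<le> card Q" and "D \<in> cocycles"
  shows "2 * card (D \<inter> T) \<le> card D"
proof -
  interpret D: cycle_space "dual M" cocycles by (rule dual_cycle_space)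
  show ?thesis using assms(2)
  proof (induction rule: D.cycle_induct)
    case (circuit_Un C D)
    have fin: "finite C" "finite D" using circuit_Un D.circuit_in_cycles D.finite_cycle by blast+
    have "2 * card (D \<inter> T) \<le> card D"
      using assms(1)[of D] circuit_Un unfolding cocircuit_def by (cases "D \<inter> T = {}") auto
    moreover have "card ((D \<union> C) \<inter> T) = card (D \<inter> T) + card (C \<inter> T)"
      using fin circuit_Un by (subst card_Un_disjoint[symmetric]) (auto intro: arg_cong[where f = card])
    moreover have "card (D \<union> C) = card D + card C" using fin circuit_Un by (simp add: card_Un_disjoint)
    ultimately show ?case using circuit_Un by simp
  qed simp
qed

text \<open>Both conditions say that \<open>T\<close> has Hamming distance at least \<open>card T\<close> from every cocycle.\<close>

lemma cocircuit_condition_iff_odd_circuit_condition: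
  assumes "T \<subseteq> ground M" "card T = n - 1" "n \<ge> 2"
  shows "(\<forall>Q. cocircuit M Q \<and> Q \<inter> T \<noteq> {} \<longrightarrow> card Q \<ge> 2 * card (Q \<inter> T)) \<longleftrightarrow>
         (\<forall>S. S \<subset> ground M \<and> card S = n - 2 \<longrightarrow>
              (\<exists>C. circuit M C \<and> odd (card (C \<inter> T)) \<and> C \<subseteq> ground M - S))"
    (is "?cocircuits \<longleftrightarrow> ?circuits")
proof
  have finT: "finite T" using assms(1) finite_ground finite_subset by blast
  assume ii: ?cocircuits
  show ?circuits
  proof (intro allI impI, rule ccontr)
    fix S assume S: "S \<subset> ground M \<and> card S = n - 2"
      and none: "\<nexists>C. circuit M C \<and> odd (card (C \<inter> T)) \<and> C \<subseteq> ground M - S"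
    have "even (card (C \<inter> T))" if C: "C \<in> Z" "C \<subseteq> ground M - S" for C
    proof (rule ccontr)
      assume "odd (card (C \<inter> T))"
      then obtain D where "circuit M D" "D \<subseteq> C" "odd (card (D \<inter> T))"
        using odd_cycle_contains_odd_circuit[OF C(1)] by metis
      then show False using none C(2) by (meson order_trans)
    qed
    then obtain D where D: "D \<in> cocycles" "D \<inter> (ground M - S) = T \<inter> (ground M - S)"
      using cocycle_extension[of "ground M - S" T] by blast
    have "D \<subseteq> ground M" using D unfolding cocycles_def by blast
    then have finD: "finite D" and "sym_diff D T \<subseteq> S"
      using finite_ground finite_subset D(2) assms(1) by blast+
    then have "card (sym_diff D T) \<le> n - 2"
      using S card_mono finite_ground finite_subset by (metis psubset_imp_subset)
    moreover have "2 * card (D \<inter> T) \<le> card D" using cocycle_card_bound[of T D] ii D(1) by blast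
    \<comment> \<open>The bound on \<open>D\<close> gives
      \<open>card (sym_diff D T) \<ge> card T = n - 1\<close>.\<close>
    ultimately show False using card_sym_diff[OF finD finT] assms by linarith
  qed
next
  have finT: "finite T" using assms(1) finite_ground finite_subset by blast
  assume iii: ?circuits
  show ?cocircuits
  proof (intro allI impI, rule ccontr)
    fix Q assume Q: "cocircuit M Q \<and> Q \<inter> T \<noteq> {}" and "\<not> card Q \<ge> 2 * card (Q \<inter> T)"
    then have lt: "card Q < 2 * card (Q \<inter> T)" by simp
    have QD: "Q \<in> cocycles" using Q cocircuit_imp_cocycle by blast
    then have QE: "Q \<subseteq> ground M" unfolding cocycles_def by blast
    then have finQ: "finite Q" using finite_ground finite_subset by blast
    \<comment> \<open>The violated inequality makes \<open>card (sym_diff Q T)\<close> smaller than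
      \<open>card T\<close>; the set is then padded to exactly \<open>n - 2\<close>
      elements.\<close>
    have small: "card (sym_diff Q T) \<le> n - 2"
      using card_sym_diff[OF finQ finT] lt assms by linarith
    have "n - 1 \<le> card (ground M)" using assms card_mono[OF finite_ground] by metis
    then have big: "n - 2 < card (ground M)" using assms(3) by linarith
    have "sym_diff Q T \<subseteq> ground M" using QE assms(1) by blast
    then obtain S where S: "sym_diff Q T \<subseteq> S" "S \<subseteq> ground M" "card S = n - 2"
      using exists_subset_between[of "sym_diff Q T" "n - 2" "ground M"] small big finite_ground by auto
    then have "S \<subset> ground M" using big by auto
    then obtain C where C: "circuit M C" "odd (card (C \<inter> T))" "C \<subseteq> ground M - S"
      using iii S(3) by metis
    \<comment> \<open>\<open>C\<close> avoids \<open>S\<close>, which holds every element where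
      \<open>Q\<close> and \<open>T\<close> differ.\<close>
    have "C \<inter> T = C \<inter> Q" using C(3) S(1) by blast
    then show False using C QD circuit_in_cycles(1) unfolding cocycles_def by auto
  qed
qed

end

section \<open>Connectivity of the element splitting\<close>

lemma separation_commute: "separation M k X Y \<longleftrightarrow> separation M k Y X"
  unfolding separation_def by (auto simp: Un_commute Int_commute min.commute add.commute)

lemma cycle_space_null_sets:
  assumes "finite (ground M)" "M = vector_matroid m (ground M) A"
  shows "cycle_space M (null_sets m (ground M) A)"
proof
  show "sym_diff C D \<in> null_sets m (ground M) A"
    if "C \<in> null_sets m (ground M) A" "D \<in> null_sets m (ground M) A" for C D
  proof -
    have "finite C" "finite D" using that assms(1) finite_subset unfolding null_sets_def by blast+
    then show ?thesis using that by (auto simp: null_sets_def sum_sym_diff_bit)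
  qed
  show "indep M X \<longleftrightarrow> X \<subseteq> ground M \<and> (\<forall>C\<in>null_sets m (ground M) A. C \<subseteq> X \<longrightarrow> C = {})" for X
    using indep_vector_matroid_iff[OF assms(1), of m A X] assms(2) by simp
qed (use assms in \<open>auto simp: null_sets_def\<close>)

text \<open>Only the effect on cycles is kept from the matrix: deleting \<open>a\<close> leaves the
  even cycles of \<open>M\<close>, and contracting \<open>a\<close> gives back
  \<open>M\<close>.\<close>

locale splitting = cycle_space M Z for M :: "'e matroid_data" and Z +
  fixes T :: "'e set" and a :: 'e and N :: "'e matroid_data"
  assumes matroid: "matroid M"
    and new_element: "a \<notin> ground M"
    and ground_N: "ground N = insert a (ground M)"
    and indep_N_iff: "X \<subseteq> ground M \<Longrightarrow>
          indep N X \<longleftrightarrow> (\<forall>C\<in>Z. C \<subseteq> X \<longrightarrow> even (card (C \<inter> T)) \<longrightarrow> C = {})"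
    and indep_N_insert_iff: "X \<subseteq> ground M \<Longrightarrow> indep N (insert a X) \<longleftrightarrow> indep M X"
begin

lemma indep_imp_indep_N: "indep M X \<Longrightarrow> indep N X"
  using indep_N_iff[of X] unfolding indep_iff by blast

lemma indep_empty: "indep M {}" "indep N {}"
  using indep_imp_indep_N by (simp_all add: indep_iff)

lemma finite_subset_ground: "X \<subseteq> ground M \<Longrightarrow> finite X"
  using finite_ground finite_subset by blast

text \<open>An independent set of \<open>N\<close> avoiding \<open>a\<close> contains at most one nonempty cycle of \<open>M\<close>, because
  the sum of two odd cycles is even.\<close>

lemma card_indep_N_le:
  assumes "X \<subseteq> ground M" "I \<subseteq> X" "indep N I"
  shows "card I \<le> Suc (rank M X)"
proof (cases "indep M I")
  case True
  then show ?thesis using rank_ge[of X I M] assms finite_subset_ground by fastforce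
next
  case False
  have IE: "I \<subseteq> ground M" using assms by blast
  have odd: "odd (card (C \<inter> T))" if "C \<in> Z" "C \<subseteq> I" "C \<noteq> {}" for C
    using assms(3) that unfolding indep_N_iff[OF IE] by blast
  obtain C where C: "C \<in> Z" "C \<subseteq> I" "C \<noteq> {}" using False IE unfolding indep_iff by blast
  then obtain e where e: "e \<in> C" by blast
  have "D = {}" if D: "D \<in> Z" "D \<subseteq> I - {e}" for D
  proof (rule ccontr)
    assume "D \<noteq> {}"
    then have "odd (card (D \<inter> T))" "odd (card (C \<inter> T))" using odd C D by blast+
    then have "even (card (sym_diff C D \<inter> T))"
      using even_card_Int_sym_diff finite_cycle C D by blast
    moreover have "sym_diff C D \<in> Z" using cycle_sym_diff C D by blast
    moreover have "sym_diff C D \<subseteq> I" "sym_diff C D \<noteq> {}" using C D e by blast+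
    ultimately show False using odd by blast
  qed
  then have "indep M (I - {e})" using IE unfolding indep_iff by blast
  then have "card (I - {e}) \<le> rank M X"
    using rank_ge[of X "I - {e}" M] assms finite_subset_ground by blast
  then show ?thesis using e C IE finite_subset_ground by (metis card_Suc_Diff1 Suc_le_mono in_mono)
qed

text \<open>For the upper bound, an independent set of \<open>N\<close> either contains
  \<open>a\<close>, and the rest is independent in \<open>M\<close>, or avoids \<open>a\<close>, and
  \<open>card_indep_N_le\<close> applies. Adding \<open>a\<close> to a largest independent subset of
  \<open>X\<close> attains it.\<close>

lemma rank_N_insert:
  assumes "X \<subseteq> ground M"
  shows "rank N (insert a X) = Suc (rank M X)"
proof (rule antisym)
  have fin: "finite X" using assms finite_subset_ground by blast
  obtain J where J: "J \<subseteq> insert a X" "indep N J" "card J = rank N (insert a X)"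
    using rank_witness[of "insert a X" N] fin indep_empty by blast
  show "rank N (insert a X) \<le> Suc (rank M X)"
  proof (cases "a \<in> J")
    case True
    then have "J = insert a (J - {a})" by blast
    then have "indep M (J - {a})" using J assms indep_N_insert_iff[of "J - {a}"] by auto
    then have "card (J - {a}) \<le> rank M X" using rank_ge[of X "J - {a}" M] fin J by blast
    then show ?thesis using J True fin
      by (metis card_Suc_Diff1 Suc_le_mono finite_insert finite_subset)
  next
    case False
    then show ?thesis using card_indep_N_le[OF assms, of J] J by auto
  qed
  obtain I where I: "I \<subseteq> X" "indep M I" "card I = rank M X"
    using rank_witness[of X M] fin indep_empty by blast
  have "a \<notin> I" "finite I" using I assms new_element fin finite_subset by blast+
  moreover have "indep N (insert a I)" using I assms indep_N_insert_iff[of I] by blast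
  ultimately show "Suc (rank M X) \<le> rank N (insert a X)"
    using rank_ge[of "insert a X" "insert a I" N] fin I by auto
qed

text \<open>Extend \<open>C - {e}\<close> to a maximal independent set \<open>B\<close> of
  \<open>Y\<close> and put \<open>e\<close> back. The only nonempty cycle of \<open>M\<close>
  created is \<open>C\<close>, which is odd and hence harmless in \<open>N\<close>.\<close>

lemma rank_N_odd_circuit:
  assumes "Y \<subseteq> ground M" "circuit M C" "C \<subseteq> Y" "odd (card (C \<inter> T))"
  shows "Suc (rank M Y) \<le> rank N Y"
proof -
  have fin: "finite Y" using assms finite_subset_ground by blast
  note C = circuit_in_cycles[OF assms(2)]
  obtain e where e: "e \<in> C" using C by blast
  then have "indep M (C - {e})" using assms(2) unfolding circuit_def by blast
  moreover have "C - {e} \<subseteq> Y" using assms(3) by blast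
  ultimately obtain B where B: "C - {e} \<subseteq> B" "B \<subseteq> Y" "indep M B" "card B = rank M Y"
    using indep_extend_to_rank[OF matroid fin] by metis
  have "e \<notin> B" using B C e unfolding indep_iff by blast
  have "D = {}" if D: "D \<in> Z" "D \<subseteq> insert e B" "even (card (D \<inter> T))" for D
  proof (cases "e \<in> D")
    case True
    then have "sym_diff C D \<subseteq> B" using D B e by blast
    then have "sym_diff C D = {}" using cycle_sym_diff C D B unfolding indep_iff by blast
    then show ?thesis using D assms(4) by (metis Diff_eq_empty_iff Un_empty subset_antisym)
  next
    case False
    then show ?thesis using D B unfolding indep_iff by blast
  qed
  moreover have "insert e B \<subseteq> Y" using B e assms by blast
  ultimately have "indep N (insert e B)" using indep_N_iff[of "insert e B"] assms by blast
  then have "card (insert e B) \<le> rank N Y" using rank_ge fin \<open>insert e B \<subseteq> Y\<close> by blast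
  then show ?thesis using B fin \<open>e \<notin> B\<close> finite_subset by (metis card_insert_disjoint)
qed

text \<open>A set independent in \<open>N\<close> but not in \<open>M\<close> contains a circuit of
  \<open>M\<close>, which must be odd.\<close>

lemma rank_N_no_odd_circuit:
  assumes "Y \<subseteq> ground M" "\<And>C. circuit M C \<Longrightarrow> C \<subseteq> Y \<Longrightarrow> even (card (C \<inter> T))"
  shows "rank N Y \<le> rank M Y"
proof -
  have fin: "finite Y" using assms finite_subset_ground by blast
  obtain J where J: "J \<subseteq> Y" "indep N J" "card J = rank N Y"
    using rank_witness[of Y N] fin indep_empty by blast
  have "indep M J"
  proof (rule ccontr)
    assume "\<not> indep M J"
    moreover have JE: "J \<subseteq> ground M" using J assms by blast
    ultimately obtain C where C: "circuit M C" "C \<subseteq> J" using contains_circuit by blast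
    then have "even (card (C \<inter> T))" using assms(2)[of C] J by blast
    then show False using J(2) C circuit_in_cycles[OF C(1)] unfolding indep_N_iff[OF JE] by blast
  qed
  then show ?thesis using rank_ge[of Y J M] fin J by simp
qed

lemma n_connected_iff_odd_circuit_condition:
  assumes conn: "n_connected n M" and n: "n \<ge> 2" and card: "card (ground M) \<ge> 2 * n - 2"
  shows "n_connected n N \<longleftrightarrow>
         (\<forall>S. S \<subset> ground M \<and> card S = n - 2 \<longrightarrow>
              (\<exists>C. circuit M C \<and> odd (card (C \<inter> T)) \<and> C \<subseteq> ground M - S))"
    (is "?conn \<longleftrightarrow> ?circuits")
proof
  assume i: ?conn
  show ?circuits
  proof (intro allI impI, rule ccontr)
    fix S assume S: "S \<subset> ground M \<and> card S = n - 2"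
      and none: "\<nexists>C. circuit M C \<and> odd (card (C \<inter> T)) \<and> C \<subseteq> ground M - S"
    let ?X = "insert a S" and ?Y = "ground M - S"
    have SE: "S \<subseteq> ground M" and finS: "finite S" using S finite_subset_ground by blast+
    have "a \<notin> S" using SE new_element by blast
    then have cX: "card ?X = n - 1" using S finS n by auto
    have cY: "card ?Y \<ge> n - 1" using card_Diff_subset[OF finS SE] S card n by linarith
    have "rank M S \<le> card S"
      using rank_witness[OF finS indep_empty(1)] finS by (metis card_mono)
    then have "rank N ?X \<le> n - 1" using rank_N_insert[OF SE] S n by linarith
    moreover have "rank N ?Y \<le> rank M ?Y" using rank_N_no_odd_circuit[of ?Y] none by blast
    moreover have "rank M ?Y \<le> rank M (ground M)"
    proof -
      obtain I where "I \<subseteq> ?Y" "indep M I" "card I = rank M ?Y"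
        using rank_witness[of ?Y M] finite_ground indep_empty by blast
      then show ?thesis using rank_ge[of "ground M" I M] finite_ground by auto
    qed
    moreover have "rank N (ground N) = Suc (rank M (ground M))"
      using rank_N_insert[of "ground M"] ground_N by simp
    \<comment> \<open>The sum is at most \<open>(n - 1) + r - (r + 1)\<close>, where
      \<open>r\<close> is the rank of \<open>M\<close>.\<close>
    ultimately have "int (rank N ?X) + int (rank N ?Y) - int (rank N (ground N)) \<le> int (n - 1) - 1"
      by linarith
    moreover have "?X \<union> ?Y = ground N" "?X \<inter> ?Y = {}"
      using SE ground_N new_element by blast+
    ultimately have "separation N (n - 1) ?X ?Y" using cX cY unfolding separation_def by simp
    moreover have "1 \<le> n - 1" "n - 1 < n" using n by linarith+
    ultimately show False using i unfolding n_connected_def by blast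
  qed
next
  assume iii: ?circuits
  \<comment> \<open>By symmetry only the case where \<open>a\<close> lies in the first part needs an
    argument.\<close>
  have no_sep: False if k: "1 \<le> k" "k < n" and sep: "separation N k X' Y" and aX: "a \<in> X'" for k X' Y
  proof -
    let ?X = "X' - {a}"
    have un: "X' \<union> Y = insert a (ground M)" and disj: "X' \<inter> Y = {}"
      using sep ground_N unfolding separation_def by auto
    have XE: "?X \<subseteq> ground M" and YE: "Y \<subseteq> ground M" and part: "?X \<union> Y = ground M" "?X \<inter> Y = {}"
      using un disj aX new_element by blast+
    have X': "insert a ?X = X'" using aX by blast
    have finX: "finite ?X" using XE finite_subset_ground by blast
    have cX: "card X' = Suc (card ?X)" using finX X' by (metis DiffE card_insert_disjoint singletonI)
    have rX: "rank N X' = Suc (rank M ?X)" using rank_N_insert[OF XE] X' by simp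
    have rE: "rank N (ground N) = Suc (rank M (ground M))"
      using rank_N_insert[of "ground M"] ground_N by simp
    have ineq: "int (rank M ?X) + int (rank N Y) - int (rank M (ground M)) \<le> int k - 1"
      using sep rX rE unfolding separation_def by simp
    have k_le: "k \<le> card X'" "k \<le> card Y" using sep unfolding separation_def by auto
    have rY: "rank M Y \<le> rank N Y"
      using rank_witness[of Y M] rank_ge[of Y _ N] indep_imp_indep_N YE finite_subset_ground indep_empty
      by metis
    have no_sep_M: "\<not> separation M j ?X Y" if "1 \<le> j" "j < n" for j
      using conn that unfolding n_connected_def by blast
    have "\<not> separation M k ?X Y" using no_sep_M k by blast
    \<comment> \<open>Since \<open>rank M Y \<le> rank N Y\<close>, a larger \<open>?X\<close> would
      give a \<open>k\<close>-separation of \<open>M\<close>.\<close>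
    then have "card ?X < k" using part ineq rY k_le unfolding separation_def by auto
    then have cX': "card ?X = k - 1" using cX k_le by linarith
    have big: "n - 2 < card (ground M)" using card n by linarith
    have "card ?X \<le> n - 2" using cX' k by linarith
    then obtain S where S: "?X \<subseteq> S" "S \<subseteq> ground M" "card S = n - 2"
      using exists_subset_between[of ?X "n - 2" "ground M"] big finite_ground XE by auto
    then have "S \<subset> ground M" using big by auto
    then obtain C where C: "circuit M C" "odd (card (C \<inter> T))" "C \<subseteq> ground M - S"
      using iii S(3) by metis
    then have "C \<subseteq> Y" using S part by blast
    then have rY': "Suc (rank M Y) \<le> rank N Y" using rank_N_odd_circuit[OF YE C(1)] C(2) by blast
    show False
    \<comment> \<open>Connectivity says nothing about a \<open>0\<close>-separation, so
      \<open>k = 1\<close> is refuted directly by the rank of \<open>Y = ground M\<close>.\<close>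
    proof (cases "k = 1")
      case True
      then have "?X = {}" using cX' finX by simp
      then have "Y = ground M" using part by blast
      then show False using rY' ineq True by simp
    next
      case False
      have "int (rank M ?X) + int (rank M Y) - int (rank M (ground M)) \<le> int (k - 1) - 1"
        using ineq rY' k by linarith
      then have "separation M (k - 1) ?X Y" using part cX' k_le unfolding separation_def by simp
      moreover have "1 \<le> k - 1" "k - 1 < n" using False k by linarith+
      ultimately show False using no_sep_M by blast
    qed
  qed
  show ?conn
    unfolding n_connected_def
  proof (intro allI impI notI)
    fix k X Y assume k: "1 \<le> k" "k < n" and sep: "separation N k X Y"
    then have "a \<in> X \<or> a \<in> Y" using ground_N unfolding separation_def by blast
    then show False using no_sep[OF k] sep separation_commute by blast
  qed
qed

end

text \<open>The cycles of the new matrix are the even cycles \<open>C\<close> of \<open>M\<close>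
  and the sets \<open>insert a C\<close> with \<open>C\<close> an odd cycle. Inside
  \<open>insert a X\<close> they therefore correspond to all cycles of \<open>M\<close> inside
  \<open>X\<close>.\<close>

lemma splitting_element_splitting:
  assumes "matroid M" "M = vector_matroid m (ground M) A" "a \<notin> ground M"
  shows "splitting M (null_sets m (ground M) A) T a (element_splitting (ground M) m A T a)"
proof -
  let ?N = "element_splitting (ground M) m A T a" and ?Z = "null_sets m (ground M) A"
  let ?Z' = "null_sets (Suc m) (insert a (ground M)) (splitting_matrix m A T a)"
  have fin: "finite (ground M)" using assms(1) unfolding matroid_def by blast
  interpret cycle_space M ?Z using cycle_space_null_sets[OF fin assms(2)] .
  have indep_N: "indep ?N X \<longleftrightarrow> X \<subseteq> insert a (ground M) \<and> (\<forall>C\<in>?Z'. C \<subseteq> X \<longrightarrow> C = {})" for X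
    unfolding element_splitting_def using fin by (intro indep_vector_matroid_iff) simp
  note null = null_sets_splitting_matrix[OF fin assms(3)]
  show ?thesis
  proof
    show "ground ?N = insert a (ground M)" by (simp add: element_splitting_def vector_matroid_def)
    fix X assume X: "X \<subseteq> ground M"
    have sub: "C \<in> ?Z' \<longleftrightarrow> C \<in> ?Z \<and> even (card (C \<inter> T))" if "C \<subseteq> X" for C
      using null(1)[of C] that X by blast
    have sub_insert: "insert a C \<in> ?Z' \<longleftrightarrow> C \<in> ?Z \<and> odd (card (C \<inter> T))" if "C \<subseteq> X" for C
      using null(2)[of C] that X by blast
    show "indep ?N X \<longleftrightarrow> (\<forall>C\<in>?Z. C \<subseteq> X \<longrightarrow> even (card (C \<inter> T)) \<longrightarrow> C = {})"
      unfolding indep_N using X sub by blast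
    show "indep ?N (insert a X) \<longleftrightarrow> indep M X"
    proof
      assume N: "indep ?N (insert a X)"
      have "C = {}" if C: "C \<in> ?Z" "C \<subseteq> X" for C
      proof (cases "even (card (C \<inter> T))")
        case True
        then show ?thesis using N C sub[of C] unfolding indep_N by blast
      next
        case False
        then have "insert a C \<in> ?Z'" "insert a C \<subseteq> insert a X" using C sub_insert by blast+
        then have "insert a C = {}" using N unfolding indep_N by metis
        then show ?thesis by simp
      qed
      then show "indep M X" using X unfolding indep_iff by blast
    next
      assume M: "indep M X"
      have "C = {}" if C: "C \<in> ?Z'" "C \<subseteq> insert a X" for C
      proof (cases "a \<in> C")
        case True
        then have C': "insert a (C - {a}) = C" "C - {a} \<subseteq> X" using C by blast+
        then have "C - {a} \<in> ?Z" and odd: "odd (card ((C - {a}) \<inter> T))"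
          using C sub_insert[of "C - {a}"] by auto
        then have "C - {a} = {}" using M C' unfolding indep_iff by blast
        \<comment> \<open>\<open>C = {a}\<close> is impossible, because the empty cycle is
          even.\<close>
        then show ?thesis using odd by (metis Int_empty_left card.empty dvd_0_right)
      next
        case False
        then have "C \<subseteq> X" using C by blast
        then show ?thesis using M C sub[of C] unfolding indep_iff by blast
      qed
      then show "indep ?N (insert a X)" unfolding indep_N using X by blast
    qed
  qed (use assms in auto)
qed

theorem theorem3p5:
  fixes n m :: nat
    and M :: "'e matroid_data"
    and A :: "nat \<Rightarrow> 'e \<Rightarrow> bit"
    and T :: "'e set"
    and a :: 'e
  assumes "n \<ge> 2"
    and "matroid M"
    and "standard_representation M m A"
    and "n_connected n M"
    and "card (ground M) \<ge> 2 * n - 2"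
    and "T \<subset> ground M"
    and "card T = n - 1"
    and "a \<notin> ground M"
  shows "(n_connected n (element_splitting (ground M) m A T a) \<longleftrightarrow>
           (\<forall>Q. cocircuit M Q \<and> Q \<inter> T \<noteq> {} \<longrightarrow> card Q \<ge> 2 * card (Q \<inter> T)))
       \<and> ((\<forall>Q. cocircuit M Q \<and> Q \<inter> T \<noteq> {} \<longrightarrow> card Q \<ge> 2 * card (Q \<inter> T)) \<longleftrightarrow>
           (\<forall>S. S \<subset> ground M \<and> card S = n - 2 \<longrightarrow>
              (\<exists>C. circuit M C \<and> odd (card (C \<inter> T)) \<and> C \<subseteq> ground M - S)))"
proof -
  have M: "M = vector_matroid m (ground M) A"
    using assms(3) unfolding standard_representation_def by blast
  interpret splitting M "null_sets m (ground M) A" T a "element_splitting (ground M) m A T a"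
    using splitting_element_splitting[OF assms(2) M assms(8)] .
  show ?thesis
    using n_connected_iff_odd_circuit_condition[OF assms(4,1,5)]
      cocircuit_condition_iff_odd_circuit_condition[OF psubset_imp_subset[OF assms(6)] assms(7,1)]
    by simp
qed

end
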